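(* For any $A \in \mathcal{S}(3)$ there exists a matrix $B \in \mathcal{S}(3)$ with the same eigenvalues as $A$ (counted with multiplicity) such that $B \in \mathrm{Iso}(\Lambda)$, where $\Lambda$ is the vector of these eigenvalues; that is, $B = Q(D(\Lambda)+V)Q^{\mathrm T}$ for some $Q \in \mathrm{O}(3)$ and $V \in \mathcal{V}_t$. Moreover, if $A \in \mathcal{S}(3)$ has an eigenvalue $\lambda = \lambda_R + i\lambda_I$ with $\lambda_R,\lambda_I\in\mathbb{R}$, $\lambda_I \neq 0$, then the matrix $$B = \mathrm{circ}\bigl(F_3^{-1}(1,\lambda,\bar\lambda)^{\mathrm T}\bigr)$$ belongs to $\mathcal{S}(3)$, has the same eigenvalues as $A$, and possesses the decomposition $$B = Q \begin{pmatrix} 1 & 0 & 0\\ 0 & \lambda_R & \lambda_I\\ 0 & -\lambda_I & \lambda_R\end{pmatrix} Q^{\mathrm T},$$ where $Q$ is any matrix of the form $$Q = \frac{1}{\sqrt3}\begin{pmatrix} 1 & \sqrt3\, q_1 & q_3-q_2\\ 1 & \sqrt3\, q_2 & q_1-q_3\\ 1 & \sqrt3\, q_3 & q_2-q_1\end{pmatrix},\qquad q_1,q_2\in\mathbb{R},\quad q_3 = -(q_1+q_2),\quad q_1^2+q_2^2+q_1q_2 = \tfrac12 .$$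
   Context: $\mathcal{S}(n)$ denotes the set of stochastic $n\times n$ matrices, i.e. real matrices with nonnegative entries and all row sums equal to $1$. $\mathrm{O}(n)$ is the set of real orthogonal $n\times n$ matrices. Isospectral matrices: let $\Lambda=(\lambda_1,\dots,\lambda_n)^{\mathrm T}$ with $\lambda_1,\dots,\lambda_s\in\mathbb{R}$, $\lambda_{s+1},\dots,\lambda_n\in\mathbb{C}\setminus\mathbb{R}$, $\lambda_{s+2j}=\overline{\lambda_{s+2j-1}}$ for $j=1,\dots,t$, where $t=(n-s)/2$. Let $D(\Lambda)$ be the real block diagonal matrix $\mathrm{blockdiag}(\lambda_1,\dots,\lambda_s,\lambda_1^{[2]},\dots,\lambda_t^{[2]})$ with $$\lambda_j^{[2]}=\begin{pmatrix}\mathrm{Re}(\lambda_{s+2j-1}) & \mathrm{Im}(\lambda_{s+2j-1})\\ -\mathrm{Im}(\lambda_{s+2j-1}) & \mathrm{Re}(\lambda_{s+2j-1})\end{pmatrix}.$$ Let $\mathcal{V}_t$ be the set of real upper triangular $n\times n$ matrices $V=(v_{ij})$ with zero diagonal and $v_{s+2j-1,s+2j}=0$ for $j=1,\dots,t$. Then $\mathrm{Iso}(\Lambda)=\{Q(D(\Lambda)+V)Q^{\mathrm T}: Q\in \mathrm{O}(n),\ V\in\mathcal{V}_t\}$. Circulant matrices: $F_n=(e^{-2\pi i jk/n})_{j,k=0}^{n-1}$ is the $n$-th Fourier matrix, and for $a=(a_0,\dots,a_{n-1})^{\mathrm T}$, $\mathrm{circ}(a)=a_0I_n+a_1P_n+\dots+a_{n-1}P_n^{n-1}$,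 where $P_n$ is the cyclic shift matrix with $(P_nx)_k=x_{k-1}$, indices modulo $n$ (so the first row of $P_n$ is $(0,\dots,0,1)$ and its lower left $(n-1)\times(n-1)$ block is $I_{n-1}$). *)

theory Defs
  imports
    Complex_Main
    "HOL-Computational_Algebra.Fundamental_Theorem_Algebra"
    "Jordan_Normal_Form.Char_Poly"
    "Jordan_Normal_Form.Gauss_Jordan_Elimination"
begin

definition stochastic_mats :: "nat \<Rightarrow> real mat set" where
  "stochastic_mats n = {A \<in> carrier_mat n n.
     (\<forall>i<n. \<forall>j<n. 0 \<le> A $$ (i, j)) \<and> (\<forall>i<n. (\<Sum>j<n. A $$ (i, j)) = 1)}"

(* Note that orthogonal_mat from the theory Matrix only requires pairwise orthogonal
   nonzero columns, without normalization. *)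
definition orthogonal_group :: "nat \<Rightarrow> real mat set" where
  "orthogonal_group n = {Q \<in> carrier_mat n n.
     inverts_mat Q (transpose_mat Q) \<and> inverts_mat (transpose_mat Q) Q}"

definition cmat :: "real mat \<Rightarrow> complex mat" where
  "cmat = map_mat complex_of_real"

(* The complex eigenvalues of a real matrix with their algebraic multiplicities. *)
definition eigenvalues :: "real mat \<Rightarrow> complex multiset" where
  "eigenvalues A = proots (char_poly (cmat A))"

(* The numbers s of real entries and t = (n - s) / 2 of conjugate pairs of the vector
   (lambda_1, ..., lambda_n); they are determined by the vector. *)
definition num_real :: "complex vec \<Rightarrow> nat" where
  "num_real \<Lambda> = card {i. i < dim_vec \<Lambda> \<and> \<Lambda> $ i \<in> \<real>}"

definition num_pairs :: "complex vec \<Rightarrow> nat" where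
  "num_pairs \<Lambda> = (dim_vec \<Lambda> - num_real \<Lambda>) div 2"

(* Real entries first, then the nonreal entries in consecutive conjugate pairs. Indices
   start at 0, so that lambda_{s+2j-1}, lambda_{s+2j} for 1 <= j <= t become the entries
   with indices s+2j, s+2j+1 for j < t. *)
definition conjugate_ordered :: "complex vec \<Rightarrow> bool" where
  "conjugate_ordered \<Lambda> \<longleftrightarrow> (let n = dim_vec \<Lambda>; s = num_real \<Lambda>; t = num_pairs \<Lambda> in
     n = s + 2 * t \<and>
     (\<forall>i<s. \<Lambda> $ i \<in> \<real>) \<and>
     (\<forall>i. s \<le> i \<and> i < n \<longrightarrow> \<Lambda> $ i \<notin> \<real>) \<and>
     (\<forall>j<t. \<Lambda> $ (s + 2 * j + 1) = cnj (\<Lambda> $ (s + 2 * j))))"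

(* The order within the real entries, the order of the pairs, and the order within each
   pair are not prescribed, so a matrix may have several eigenvalue vectors. *)
definition eigenvalue_vector :: "real mat \<Rightarrow> complex vec \<Rightarrow> bool" where
  "eigenvalue_vector A \<Lambda> \<longleftrightarrow>
     conjugate_ordered \<Lambda> \<and> mset (list_of_vec \<Lambda>) = eigenvalues A"

definition conj_block :: "complex \<Rightarrow> real mat" where
  "conj_block z = mat_of_rows_list 2 [[Re z, Im z], [- Im z, Re z]]"

definition block_D :: "complex vec \<Rightarrow> real mat" where
  "block_D \<Lambda> = diag_block_mat
     (map (\<lambda>i. mat 1 1 (\<lambda>_. Re (\<Lambda> $ i))) [0..<num_real \<Lambda>] @
      map (\<lambda>j. conj_block (\<Lambda> $ (num_real \<Lambda> + 2 * j))) [0..<num_pairs \<Lambda>])"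

definition V_set :: "nat \<Rightarrow> nat \<Rightarrow> nat \<Rightarrow> real mat set" where
  "V_set n s t = {V \<in> carrier_mat n n. upper_triangular V \<and> (\<forall>i<n. V $$ (i, i) = 0) \<and>
     (\<forall>j<t. V $$ (s + 2 * j, s + 2 * j + 1) = 0)}"

definition Iso :: "complex vec \<Rightarrow> real mat set" where
  "Iso \<Lambda> = {Q * (block_D \<Lambda> + V) * transpose_mat Q | Q V.
     Q \<in> orthogonal_group (dim_vec \<Lambda>) \<and>
     V \<in> V_set (dim_vec \<Lambda>) (num_real \<Lambda>) (num_pairs \<Lambda>)}"

definition fourier_mat :: "nat \<Rightarrow> complex mat" where
  "fourier_mat n = mat n n (\<lambda>(j, k).
     exp (- 2 * complex_of_real pi * \<i> * of_nat j * of_nat k / of_nat n))"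

definition cyclic_shift :: "nat \<Rightarrow> 'a :: semiring_1 mat" where
  "cyclic_shift n = mat n n (\<lambda>(j, k). if j = (k + 1) mod n then 1 else 0)"

(* The matrix sum of a_k P_n^k over k < n, written entrywise. *)
definition circ :: "'a :: semiring_1 vec \<Rightarrow> 'a mat" where
  "circ a = (let n = dim_vec a in
     mat n n (\<lambda>ij. \<Sum>k<n. a $ k * (cyclic_shift n ^\<^sub>m k) $$ ij))"

end

theory Submission
  imports Defs "Jordan_Normal_Form.Schur_Decomposition"
begin

text \<open>If all eigenvalues of \<open>A\<close> are real, take \<open>B = A\<close>: deflating one eigenvector at a time gives an
  orthogonal Schur form with the eigenvalues on the diagonal in any prescribed order. Otherwise the
  eigenvalues are \<open>1, z, cnj z\<close>, and the entries of \<open>circ (F\<^sup>-\<^sup>1 (1, z, cnj z))\<close> are \<open>(1 + 2 Re z) / 3\<close>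
  and \<open>(1 - Re z \<mp> \<surd>3 Im z) / 3\<close>. The first is a third of the trace of \<open>A\<close>. The other two are
  nonnegative because \<open>tr (A\<^sup>2) \<ge> (tr A)\<^sup>2 / 3\<close> for a nonnegative \<open>3 \<times> 3\<close> matrix, which for these
  eigenvalues reads \<open>3 (Im z)\<^sup>2 \<le> (1 - Re z)\<^sup>2\<close>.\<close>

section \<open>Orthogonal Schur form of real matrices\<close>

text \<open>Gram-Schmidt applied to a basis completing \<open>v\<close> keeps \<open>v\<close> as
  its first vector, and dividing each resulting vector by its norm gives the columns of an
  orthogonal matrix. The scalar \<open>c\<close> is the inverse norm of \<open>v\<close>; it stays
  unspecified because only the direction of the column matters.\<close>

lemma orthogonal_group_first_column:
  fixes v :: "real vec"
  assumes v: "v \<in> carrier_vec n" "v \<noteq> 0\<^sub>v n"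
  obtains U c where "U \<in> orthogonal_group n" "col U 0 = c \<cdot>\<^sub>v v"
proof -
  have n: "0 < n"
    using v by (cases n) auto
  interpret cof_vec_space n "TYPE(real)" .
  define ws where "ws = gram_schmidt n (basis_completion v)"
  note bc = basis_completion[OF v]
  have ws: "set ws \<subseteq> carrier_vec n" "corthogonal ws" "length ws = n"
    using gram_schmidt_result[OF bc(2,4,5) ws_def] bc(6) by auto
  obtain vs where "basis_completion v = v # vs"
    using bc(6,7) n by (cases "basis_completion v") auto
  then have "hd ws = v"
    using gram_schmidt_hd[OF v(1), of vs] ws_def by simp
  then have ws0: "ws ! 0 = v"
    using ws(3) n by (subst hd_conv_nth[symmetric]) auto
  have wsi: "ws ! i \<in> carrier_vec n" if "i < n" for i
    using ws(1,3) that by auto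
  \<comment> \<open>Over the reals the conjugation in \<open>corthogonal\<close> is the identity, so
    this is the ordinary inner product.\<close>
  have orth: "ws ! i \<bullet> ws ! j = 0 \<longleftrightarrow> i \<noteq> j" if "i < n" "j < n" for i j
    using corthogonalD[OF ws(2), of i j] that ws(3) by simp
  define c where "c i = 1 / sqrt (ws ! i \<bullet> ws ! i)" for i
  have c: "c i * c i * (ws ! i \<bullet> ws ! i) = 1" if "i < n" for i
  proof -
    have "0 \<le> ws ! i \<bullet> ws ! i"
      by (auto simp: scalar_prod_def intro: sum_nonneg)
    then have "0 < ws ! i \<bullet> ws ! i"
      using orth[OF that that] by linarith
    then show ?thesis
      by (simp add: c_def field_simps)
  qed
  define U where "U = mat_of_cols n (map (\<lambda>i. c i \<cdot>\<^sub>v ws ! i) [0..<n])"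
  have U: "U \<in> carrier_mat n n"
    by (auto simp: U_def)
  have colU: "col U i = c i \<cdot>\<^sub>v ws ! i" if "i < n" for i
    using that wsi[OF that] unfolding U_def by (subst col_mat_of_cols) auto
  have UU: "transpose_mat U * U = 1\<^sub>m n"
  proof (rule eq_matI)
    fix i j assume "i < dim_row (1\<^sub>m n :: real mat)" "j < dim_col (1\<^sub>m n :: real mat)"
    then have ij: "i < n" "j < n"
      by auto
    then show "(transpose_mat U * U) $$ (i, j) = 1\<^sub>m n $$ (i, j)"
      using U wsi orth[OF ij] c[of i]
      by (auto simp: colU smult_scalar_prod_distrib[OF wsi smult_carrier_vec[THEN iffD2, OF wsi]]
          scalar_prod_smult_distrib[OF wsi wsi] mult.assoc)
  qed (use U in auto)
  then have "U * transpose_mat U = 1\<^sub>m n"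
    using mat_mult_left_right_inverse[of "transpose_mat U" n U] U by auto
  with UU U have "U \<in> orthogonal_group n"
    by (auto simp: orthogonal_group_def inverts_mat_def)
  with colU[OF n] show ?thesis
    using that ws0 by metis
qed

text \<open>Induction on the list of roots. An orthogonal change of basis starting with an
  eigenvector for the head \<open>e\<close> puts \<open>e\<close> in the corner with zeros below it,
  and the trailing block has the remaining roots. As the list fixes which root is split off first,
  the diagonal comes out in the prescribed order.\<close>

lemma real_schur_decomposition:
  fixes A :: "real mat"
  assumes "A \<in> carrier_mat n n" "char_poly A = (\<Prod>e\<leftarrow>es. [:- e, 1:])"
  shows "\<exists>T Q. similar_mat_wit A T Q (transpose_mat Q) \<and> upper_triangular T \<and> diag_mat T = es"
  using assms
proof (induction es arbitrary: n A)
  case Nil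
  then have "n = 0"
    using degree_monic_char_poly[of A n] by simp
  then show ?case
    using Nil by (intro exI[of _ A] exI[of _ "1\<^sub>m 0"])
      (auto intro: similar_mat_wit_refl simp: diag_mat_def)
next
  case (Cons e es)
  note A = Cons.prems(1)
  obtain m where n: "n = Suc m"
  proof (cases n)
    case 0
    then show ?thesis
      using Cons.prems(2) degree_monic_char_poly[OF A] degree_linear_factors[of uminus "e # es"]
      by simp
  qed
  have "eigenvalue A e"
    unfolding eigenvalue_root_char_poly[OF A] Cons.prems(2) by simp
  then obtain v where v: "v \<in> carrier_vec n" "v \<noteq> 0\<^sub>v n" and Av: "A *\<^sub>v v = e \<cdot>\<^sub>v v"
    using A by (auto simp: eigenvalue_def eigenvector_def)
  obtain U c where UO: "U \<in> orthogonal_group n" and U0: "col U 0 = c \<cdot>\<^sub>v v"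
    using orthogonal_group_first_column[OF v] .
  have U: "U \<in> carrier_mat n n" and UU: "transpose_mat U * U = 1\<^sub>m n" "U * transpose_mat U = 1\<^sub>m n"
    using UO by (auto simp: orthogonal_group_def inverts_mat_def)
  define A' where "A' = transpose_mat U * A * U"
  have A': "A' \<in> carrier_mat n n"
    using A U by (auto simp: A'_def)
  have simA: "similar_mat_wit A A' U (transpose_mat U)"
  proof (rule similar_mat_wit_sym, rule similar_mat_witI[of _ _ n])
    show "A' = transpose_mat U * A * U" by (fact A'_def)
  qed (use U UU A A' in auto)
  \<comment> \<open>The first column of \<open>U\<close> inherits the eigenvector equation from
    \<open>v\<close>, and \<open>transpose_mat U\<close> sends it to the first unit vector.\<close>
  have "col A' 0 = transpose_mat U *\<^sub>v (A *\<^sub>v col U 0)"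
    using A U n col_mult2[of "transpose_mat U" n n "A * U" n 0] col_mult2[OF A U, of 0]
    by (simp add: A'_def assoc_mult_mat[of _ n n _ n _ n])
  also have "A *\<^sub>v col U 0 = e \<cdot>\<^sub>v col U 0"
    using v A Av by (simp add: U0 mult_mat_vec smult_smult_assoc mult.commute)
  also have "transpose_mat U *\<^sub>v (e \<cdot>\<^sub>v col U 0) = e \<cdot>\<^sub>v col (transpose_mat U * U) 0"
    using U n mult_mat_vec[of "transpose_mat U" n n "col U 0" e] col_mult2[of "transpose_mat U" n n U n 0]
    by (simp add: carrier_vecI)
  finally have col0: "col A' 0 = e \<cdot>\<^sub>v unit_vec n 0"
    using n by (simp add: UU)
  have A'0: "A' $$ (i, 0) = (if i = 0 then e else 0)" if "i < n" for i
    using arg_cong[OF col0, of "\<lambda>v. v $ i"] that A' n by (auto simp: unit_vec_def)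
  define A2 where "A2 = mat 1 m (\<lambda>(i, j). A' $$ (0, Suc j))"
  define A3 where "A3 = mat m m (\<lambda>(i, j). A' $$ (Suc i, Suc j))"
  let ?E = "mat 1 1 (\<lambda>_. e)"
  have cA: "?E \<in> carrier_mat 1 1" "A2 \<in> carrier_mat 1 m" "A3 \<in> carrier_mat m m"
    by (auto simp: A2_def A3_def)
  have blk: "A' = four_block_mat ?E A2 (0\<^sub>m m 1) A3"
    by (rule eq_matI) (use A' n A'0 in \<open>auto simp: A2_def A3_def\<close>)
  have "char_poly A = char_poly A'"
    using simA by (intro char_poly_similar) (auto simp: similar_mat_def)
  also have "\<dots> = char_poly ?E * char_poly A3"
    unfolding blk by (rule char_poly_four_block_zeros_col[OF cA])
  also have "char_poly ?E = [:- e, 1:]"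
    by (simp add: char_poly_defs det_def sign_def)
  finally have "[:- e, 1:] * char_poly A3 = [:- e, 1:] * (\<Prod>e\<leftarrow>es. [:- e, 1:])"
    using Cons.prems(2) by simp
  then have "char_poly A3 = (\<Prod>e\<leftarrow>es. [:- e, 1:])"
    by (metis mult_cancel_left pCons_eq_0_iff zero_neq_one)
  from Cons.IH[OF cA(3) this] obtain T Q
    where sim: "similar_mat_wit A3 T Q (transpose_mat Q)"
      and ut: "upper_triangular T" and diag: "diag_mat T = es"
    by blast
  have T: "T \<in> carrier_mat m m" and Q: "Q \<in> carrier_mat m m"
    and QQ: "Q * transpose_mat Q = 1\<^sub>m m" "transpose_mat Q * Q = 1\<^sub>m m"
    using similar_mat_witD2[OF cA(3) sim] by auto
  \<comment> \<open>Conjugation by \<open>?P\<close> triangularises the trailing block and leaves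
    the first column alone; only the upper right block changes, to \<open>A2 * Q\<close>.\<close>
  let ?P = "four_block_mat (1\<^sub>m 1) (0\<^sub>m 1 m) (0\<^sub>m m 1) Q"
  let ?C = "four_block_mat ?E (A2 * Q) (0\<^sub>m m 1) T"
  have Pt: "transpose_mat ?P = four_block_mat (1\<^sub>m 1) (0\<^sub>m 1 m) (0\<^sub>m m 1) (transpose_mat Q)"
    using Q by (subst transpose_four_block_mat) auto
  have "similar_mat_wit A' ?C ?P (transpose_mat ?P)"
    unfolding blk Pt
    by (rule similar_mat_wit_four_block[OF similar_mat_wit_refl[OF cA(1)] sim])
      (use QQ Q cA in auto)
  then have "similar_mat_wit A ?C (U * ?P) (transpose_mat ?P * transpose_mat U)"
    by (rule similar_mat_wit_trans[OF simA])
  moreover have "transpose_mat ?P * transpose_mat U = transpose_mat (U * ?P)"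
    using U Q n by (subst transpose_mult[of _ n n _ n]) auto
  moreover have "upper_triangular ?C"
    using ut T by (intro upper_triangular_four_block[of _ 1 _ m]) auto
  moreover have "diag_mat ?C = e # es"
    using diag_four_block_mat[OF cA(1) T] diag by (auto simp: diag_mat_def)
  ultimately show ?case
    by metis
qed

section \<open>Eigenvalue vectors with real entries\<close>

lemma cmat_carrier [simp]: "cmat A \<in> carrier_mat n m \<longleftrightarrow> A \<in> carrier_mat n m"
  by (simp add: cmat_def)

lemma proots_prod_linear_factors:
  "proots (\<Prod>a\<leftarrow>as. [:- a, 1:]) = (mset as :: 'a :: idom multiset)"
proof (induction as)
  case (Cons a as)
  have "(\<Prod>a\<leftarrow>as. [:- a, 1:]) \<noteq> 0"
    by (auto simp: prod_list_zero_iff)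
  then show ?case
    using Cons by (simp add: proots_mult del: mult_pCons_left)
qed simp

text \<open>The characteristic polynomial splits over the complex numbers, and a product of linear
  factors depends only on the multiset of its roots.\<close>

lemma char_poly_cmat_eigenvalues:
  assumes "A \<in> carrier_mat n n" "mset as = eigenvalues A"
  shows "char_poly (cmat A) = (\<Prod>a\<leftarrow>as. [:- a, 1:])"
proof -
  obtain bs where bs: "char_poly (cmat A) = (\<Prod>a\<leftarrow>bs. [:- a, 1:])"
    using char_poly_factorized[of "cmat A" n] assms(1) by auto
  then have "mset bs = mset as"
    using assms(2) by (simp add: eigenvalues_def proots_prod_linear_factors)
  then show ?thesis
    unfolding bs by (metis mset_map prod_mset_prod_list)
qed

lemma size_eigenvalues:
  assumes "A \<in> carrier_mat n n"
  shows "size (eigenvalues A) = n"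
  using assms degree_monic_char_poly[of "cmat A" n] by (simp add: eigenvalues_def size_proots_complex)

lemma char_poly_cmat_nonzero:
  assumes "A \<in> carrier_mat n n"
  shows "char_poly (cmat A) \<noteq> 0"
  using degree_monic_char_poly[of "cmat A" n] assms by auto

lemma mem_eigenvalues_iff:
  assumes "A \<in> carrier_mat n n"
  shows "z \<in># eigenvalues A \<longleftrightarrow> eigenvalue (cmat A) z"
  using assms char_poly_cmat_nonzero[OF assms] eigenvalue_root_char_poly[of "cmat A" n z]
  by (simp add: eigenvalues_def)

text \<open>Since the right-hand side ignores the order of the entries, \<open>num_real\<close> can
  be read off from the eigenvalues.\<close>

lemma num_real_eq_size: "num_real \<Lambda> = size (filter_mset (\<lambda>z. z \<in> \<real>) (mset (list_of_vec \<Lambda>)))"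
proof -
  have "{i. i < dim_vec \<Lambda> \<and> \<Lambda> $ i \<in> \<real>} =
      {i. i < length (list_of_vec \<Lambda>) \<and> list_of_vec \<Lambda> ! i \<in> \<real>}"
    by (auto simp: list_of_vec_index)
  then show ?thesis
    unfolding num_real_def mset_filter[symmetric] size_mset
    by (simp add: length_filter_conv_card)
qed

text \<open>Evaluates \<open>block_D\<close> when there are no conjugate pairs.\<close>

lemma diag_block_mat_singletons:
  "diag_block_mat (map (\<lambda>i. mat 1 1 (\<lambda>_. f i)) [0..<n]) = mat n n (\<lambda>(i, j). if i = j then f i else 0)"
proof (induction n)
  case (Suc n)
  show ?case
    by (intro eq_matI) (auto simp: diag_block_mat_last Suc Let_def less_Suc_eq simp del: One_nat_def)
qed auto

text \<open>Without conjugate pairs \<open>block_D\<close> is diagonal, so a Schur form of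
  \<open>A\<close> with this diagonal differs from it by a strictly upper triangular matrix, which
  is all that \<open>V_set\<close> asks for.\<close>

lemma real_eigenvalues_mem_Iso:
  assumes A: "A \<in> carrier_mat n n" and ev: "eigenvalue_vector A \<Lambda>"
    and real: "\<And>z. z \<in># eigenvalues A \<Longrightarrow> z \<in> \<real>"
  shows "A \<in> Iso \<Lambda>"
proof -
  have mset: "mset (list_of_vec \<Lambda>) = eigenvalues A"
    using ev by (simp add: eigenvalue_vector_def)
  have dim: "dim_vec \<Lambda> = n"
    using arg_cong[OF mset, of size] size_eigenvalues[OF A] by simp
  have "filter_mset (\<lambda>z. z \<in> \<real>) (eigenvalues A) = eigenvalues A"
    using real by (simp add: filter_mset_eq_conv)
  then have nr: "num_real \<Lambda> = n"
    using size_eigenvalues[OF A] by (simp add: num_real_eq_size mset)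
  have np: "num_pairs \<Lambda> = 0"
    by (simp add: num_pairs_def nr dim)
  have D: "block_D \<Lambda> = mat n n (\<lambda>(i, j). if i = j then Re (\<Lambda> $ i) else 0)"
    using diag_block_mat_singletons[of "\<lambda>i. Re (\<Lambda> $ i)" n] by (simp add: block_D_def nr np)
  define es where "es = map Re (list_of_vec \<Lambda>)"
  have "complex_of_real (Re z) = z" if "z \<in> set (list_of_vec \<Lambda>)" for z
    using that real mset by (metis of_real_Re set_mset_mset)
  then have es: "map complex_of_real es = list_of_vec \<Lambda>"
    by (simp add: es_def o_def map_idI)
  \<comment> \<open>The embedding of real into complex polynomials is injective, so the
    factorisation of \<open>char_poly (cmat A)\<close> descends to
    \<open>char_poly A\<close>.\<close>
  interpret of_real_poly: map_poly_inj_comm_ring_hom complex_of_real ..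
  have "map_poly complex_of_real (char_poly A) = char_poly (cmat A)"
    unfolding cmat_def by (rule of_real_hom.char_poly_hom[OF A, symmetric])
  also have "\<dots> = (\<Prod>a\<leftarrow>list_of_vec \<Lambda>. [:- a, 1:])"
    by (rule char_poly_cmat_eigenvalues[OF A mset])
  also have "\<dots> = map_poly complex_of_real (\<Prod>e\<leftarrow>es. [:- e, 1:])"
    unfolding es[symmetric] by (induction es) (simp_all add: of_real_poly.hom_mult del: mult_pCons_left)
  finally have "char_poly A = (\<Prod>e\<leftarrow>es. [:- e, 1:])"
    by simp
  from real_schur_decomposition[OF A this] obtain T Q
    where sim: "similar_mat_wit A T Q (transpose_mat Q)"
      and ut: "upper_triangular T" and diag: "diag_mat T = es"
    by blast
  have T: "T \<in> carrier_mat n n" and Q: "Q \<in> carrier_mat n n"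
    and QQ: "Q * transpose_mat Q = 1\<^sub>m n" "transpose_mat Q * Q = 1\<^sub>m n"
    and AT: "A = Q * T * transpose_mat Q"
    using similar_mat_witD2[OF A sim] by auto
  have Tii: "T $$ (i, i) = Re (\<Lambda> $ i)" if "i < n" for i
    using arg_cong[OF diag, of "\<lambda>xs. xs ! i"] that T dim
    by (simp add: diag_mat_def es_def list_of_vec_index)
  define V where "V = T - block_D \<Lambda>"
  have "block_D \<Lambda> + V = T"
    by (rule eq_matI) (use T in \<open>auto simp: V_def D\<close>)
  moreover have "V \<in> V_set n n 0"
    using T ut by (auto simp: V_set_def V_def D Tii intro!: upper_triangularI upper_triangularD[OF ut])
  moreover have "Q \<in> orthogonal_group n"
    using Q QQ by (auto simp: orthogonal_group_def inverts_mat_def)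
  ultimately show ?thesis
    unfolding Iso_def dim nr np using AT by blast
qed

text \<open>Any listing of the eigenvalues works, because the order of real entries is free.\<close>

lemma real_eigenvalues_ex_eigenvalue_vector:
  assumes real: "\<And>z. z \<in># eigenvalues A \<Longrightarrow> z \<in> \<real>"
  shows "\<exists>\<Lambda>. eigenvalue_vector A \<Lambda>"
proof -
  obtain as where as: "mset as = eigenvalues A"
    using ex_mset by blast
  define \<Lambda> where "\<Lambda> = vec_of_list as"
  have real': "\<Lambda> $ i \<in> \<real>" if "i < dim_vec \<Lambda>" for i
    using that real unfolding \<Lambda>_def as[symmetric] by (auto simp: vec_of_list_index)
  then have nr: "num_real \<Lambda> = dim_vec \<Lambda>"
    by (simp add: num_real_def cong: conj_cong)
  show ?thesis
    by (rule exI[of _ \<Lambda>])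
      (use real' in \<open>simp add: eigenvalue_vector_def conjugate_ordered_def num_pairs_def nr;
        simp add: \<Lambda>_def as list_vec\<close>)
qed

section \<open>Explicit matrices of size three\<close>

lemma less_3_iff: "i < 3 \<longleftrightarrow> i = 0 \<or> i = 1 \<or> i = (2 :: nat)"
  by auto

lemma all_less_3: "(\<forall>i<3. P i) \<longleftrightarrow> P 0 \<and> P 1 \<and> P (2 :: nat)"
  by (auto simp: less_3_iff)

lemma sum_lessThan_3: "(\<Sum>i<3. f i) = f 0 + f 1 + f (2 :: nat)"
  by (simp add: eval_nat_numeral)

lemma mult_mat_3:
  assumes "A \<in> carrier_mat 3 3" "B \<in> carrier_mat 3 3" "i < 3" "j < 3"
  shows "(A * B) $$ (i, j) =
    A $$ (i, 0) * B $$ (0, j) + A $$ (i, 1) * B $$ (1, j) + A $$ (i, 2) * B $$ (2, j)"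
  using assms by (simp add: scalar_prod_def atLeast0LessThan sum_lessThan_3)

lemma eq_mat_3I:
  assumes "A \<in> carrier_mat 3 3" "B \<in> carrier_mat 3 3"
    "A $$ (0, 0) = B $$ (0, 0)" "A $$ (0, 1) = B $$ (0, 1)" "A $$ (0, 2) = B $$ (0, 2)"
    "A $$ (1, 0) = B $$ (1, 0)" "A $$ (1, 1) = B $$ (1, 1)" "A $$ (1, 2) = B $$ (1, 2)"
    "A $$ (2, 0) = B $$ (2, 0)" "A $$ (2, 1) = B $$ (2, 1)" "A $$ (2, 2) = B $$ (2, 2)"
  shows "A = B"
  using assms by (intro eq_matI) (auto simp: less_3_iff)

text \<open>With the entries as parameters, matrix identities of size three become nine scalar
  identities.\<close>

definition mat3 :: "'a \<Rightarrow> 'a \<Rightarrow> 'a \<Rightarrow> 'a \<Rightarrow> 'a \<Rightarrow> 'a \<Rightarrow> 'a \<Rightarrow> 'a \<Rightarrow> 'a \<Rightarrow> 'a mat" where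
  "mat3 a b c d e f g h i = mat_of_rows_list 3 [[a, b, c], [d, e, f], [g, h, i]]"

lemma mat3_carrier [simp]: "mat3 a b c d e f g h i \<in> carrier_mat 3 3"
  by (simp add: mat3_def mat_of_rows_list_def numeral_3_eq_3)

lemma mat3_dim [simp]: "dim_row (mat3 a b c d e f g h i) = 3" "dim_col (mat3 a b c d e f g h i) = 3"
  by (simp_all add: mat3_def mat_of_rows_list_def)

lemma mat3_index [simp]:
  "mat3 a b c d e f g h i $$ (0, 0) = a" "mat3 a b c d e f g h i $$ (0, Suc 0) = b"
  "mat3 a b c d e f g h i $$ (0, 2) = c" "mat3 a b c d e f g h i $$ (Suc 0, 0) = d"
  "mat3 a b c d e f g h i $$ (Suc 0, Suc 0) = e" "mat3 a b c d e f g h i $$ (Suc 0, 2) = f"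
  "mat3 a b c d e f g h i $$ (2, 0) = g" "mat3 a b c d e f g h i $$ (2, Suc 0) = h"
  "mat3 a b c d e f g h i $$ (2, 2) = i"
  by (simp_all add: mat3_def mat_of_rows_list_def)

lemma mat3_eta:
  assumes "A \<in> carrier_mat 3 3"
  shows "A = mat3 (A $$ (0, 0)) (A $$ (0, 1)) (A $$ (0, 2)) (A $$ (1, 0)) (A $$ (1, 1)) (A $$ (1, 2))
    (A $$ (2, 0)) (A $$ (2, 1)) (A $$ (2, 2))"
  by (rule eq_mat_3I) (use assms in simp_all)

lemma mat3_mult:
  "mat3 a b c d e f g h i * mat3 a' b' c' d' e' f' g' h' i' =
    mat3 (a * a' + b * d' + c * g') (a * b' + b * e' + c * h') (a * c' + b * f' + c * i')
         (d * a' + e * d' + f * g') (d * b' + e * e' + f * h') (d * c' + e * f' + f * i')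
         (g * a' + h * d' + i * g') (g * b' + h * e' + i * h') (g * c' + h * f' + i * i')"
  by (rule eq_mat_3I) (simp_all add: mult_mat_3[OF mat3_carrier mat3_carrier] mult_carrier_mat[OF mat3_carrier mat3_carrier] del: index_mult_mat)

lemma mat3_transpose: "transpose_mat (mat3 a b c d e f g h i) = mat3 a d g b e h c f i"
  by (rule eq_mat_3I) simp_all

lemma mat3_smult: "k \<cdot>\<^sub>m mat3 a b c d e f g h i =
    mat3 (k * a) (k * b) (k * c) (k * d) (k * e) (k * f) (k * g) (k * h) (k * i)"
  by (rule eq_mat_3I) simp_all

lemma mat3_one: "1\<^sub>m 3 = mat3 1 0 0 0 1 0 0 0 1"
  by (rule eq_mat_3I) simp_all

lemma det_2:
  assumes "A \<in> carrier_mat 2 2"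
  shows "det A = A $$ (0, 0) * A $$ (1, 1) - A $$ (0, 1) * A $$ (1, 0)"
  using assms by (subst laplace_expansion_row[of A 2 0])
    (auto simp: cofactor_def numeral_2_eq_2 mat_delete_def det_single)

lemma det_mat3:
  "det (mat3 a b c d e f g h i) = a * (e * i - f * h) - b * (d * i - f * g) + c * (d * h - e * g)"
proof -
  let ?A = "mat3 a b c d e f g h i"
  have "det ?A = (\<Sum>j<3. ?A $$ (0, j) * cofactor ?A 0 j)"
    by (rule laplace_expansion_row) auto
  moreover have "mat_delete ?A 0 j \<in> carrier_mat 2 2" for j
    by (intro carrier_matI) (simp_all add: mat_delete_def)
  ultimately show ?thesis
    by (simp add: sum_lessThan_3 cofactor_def det_2)
      (simp add: mat_delete_def mat3_def mat_of_rows_list_def algebra_simps)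
qed

text \<open>The constant coefficient is minus the determinant, the linear one is the sum of the
  principal minors of order two, and the quadratic one is minus the trace.\<close>

lemma char_poly_mat3:
  "char_poly (mat3 a b c d e f g h i) =
    [:- (a * (e * i - f * h) - b * (d * i - f * g) + c * (d * h - e * g)),
      a * e + a * i + e * i - b * d - c * g - f * h, - (a + e + i), 1:]"
proof -
  have "char_poly_matrix (mat3 a b c d e f g h i) =
      mat3 [:- a, 1:] [:- b:] [:- c:] [:- d:] [:- e, 1:] [:- f:] [:- g:] [:- h:] [:- i, 1:]"
    by (rule eq_mat_3I) (simp_all add: char_poly_matrix_def)
  then show ?thesis
    by (simp add: char_poly_def det_mat3 algebra_simps)
qed

lemma map_mat_mat3: "map_mat k (mat3 a b c d e f g h i) =
    mat3 (k a) (k b) (k c) (k d) (k e) (k f) (k g) (k h) (k i)"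
  by (rule eq_mat_3I) simp_all

section \<open>Stochastic matrices of size three\<close>

text \<open>As all row sums are one, the all-ones vector is fixed.\<close>

lemma stochastic_eigenvalue_1:
  assumes A: "A \<in> stochastic_mats n" and n: "0 < n"
  shows "1 \<in># eigenvalues A"
proof -
  have C: "A \<in> carrier_mat n n"
    using A by (simp add: stochastic_mats_def)
  have "A *\<^sub>v vec n (\<lambda>_. 1) = 1 \<cdot>\<^sub>v vec n (\<lambda>_. 1)"
    using A C by (intro eq_vecI) (auto simp: stochastic_mats_def scalar_prod_def atLeast0LessThan)
  moreover have "vec n (\<lambda>_. 1) \<noteq> (0\<^sub>v n :: real vec)"
    using n by (auto simp: vec_eq_iff)
  ultimately have "eigenvalue A 1"
    using C by (auto simp: eigenvalue_def eigenvector_def intro!: exI[of _ "vec n (\<lambda>_. 1)"])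
  then have "eigenvalue (cmat A) 1"
    using of_real_hom.eigenvalue_hom[OF C, of 1] by (simp add: cmat_def)
  then show ?thesis
    using mem_eigenvalues_iff[OF C] by simp
qed

text \<open>The characteristic polynomial has real coefficients.\<close>

lemma cnj_mem_eigenvalues:
  assumes A: "A \<in> carrier_mat n n" and z: "z \<in># eigenvalues A"
  shows "cnj z \<in># eigenvalues A"
proof -
  have "char_poly (cmat A) = map_poly of_real (char_poly A)"
    unfolding cmat_def by (rule of_real_hom.char_poly_hom[OF A])
  then have "poly (char_poly (cmat A)) (cnj z) = 0 \<longleftrightarrow> poly (char_poly (cmat A)) z = 0"
    by (intro real_poly_cnj_root_iff) (simp add: coeff_map_poly)
  then show ?thesis
    using z char_poly_cmat_nonzero[OF A] by (simp add: eigenvalues_def)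
qed

text \<open>The three numbers are distinct eigenvalues, and there is room for only three.\<close>

lemma stochastic_3_nonreal_eigenvalues:
  assumes A: "A \<in> stochastic_mats 3" and z: "z \<in># eigenvalues A" "z \<notin> \<real>"
  shows "eigenvalues A = {#1, z, cnj z#}"
proof -
  have C: "A \<in> carrier_mat 3 3"
    using A by (simp add: stochastic_mats_def)
  have neq: "1 \<noteq> z" "1 \<noteq> cnj z" "z \<noteq> cnj z"
    using z(2) by (auto simp: Reals_cnj_iff)
  have "{1, z, cnj z} \<subseteq> set_mset (eigenvalues A)"
    using stochastic_eigenvalue_1[OF A] cnj_mem_eigenvalues[OF C z(1)] z(1) by auto
  then have "count {#1, z, cnj z#} x \<le> count (eigenvalues A) x" for x
    using neq by (auto simp: Suc_le_eq)
  then have "{#1, z, cnj z#} \<subseteq># eigenvalues A"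
    by (rule mset_subset_eqI)
  moreover have "size (eigenvalues A) = size {#1, z, cnj z#}"
    using size_eigenvalues[OF C] by simp
  ultimately show ?thesis
    by (metis mset_subset_size nless_le subset_mset.nless_le)
qed

text \<open>The bounds describe the triangle spanned by the cube roots of unity. Comparing
  coefficients of the characteristic polynomial expresses the trace and the sum of principal minors
  through \<open>z\<close>; the first bound is nonnegativity of the trace.\<close>

lemma stochastic_3_nonreal_eigenvalue_bounds:
  assumes A: "A \<in> stochastic_mats 3" and z: "z \<in># eigenvalues A" "z \<notin> \<real>"
  shows "0 \<le> 1 + 2 * Re z" "sqrt 3 * \<bar>Im z\<bar> \<le> 1 - Re z"
proof -
  have C: "A \<in> carrier_mat 3 3"
    using A by (simp add: stochastic_mats_def)
  obtain a b c d e f g h i where A3: "A = mat3 a b c d e f g h i"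
    using mat3_eta[OF C] by blast
  have nonneg: "0 \<le> a" "0 \<le> b" "0 \<le> c" "0 \<le> d" "0 \<le> e" "0 \<le> f" "0 \<le> g" "0 \<le> h" "0 \<le> i"
    and sums: "a + b + c = 1" "d + e + f = 1" "g + h + i = 1"
    using A by (simp_all add: stochastic_mats_def A3 all_less_3 sum_lessThan_3 all_conj_distrib imp_disjL)
  have "char_poly (cmat A) = [:- 1, 1:] * [:- z, 1:] * [:- cnj z, 1:]"
    using char_poly_cmat_eigenvalues[OF C, of "[1, z, cnj z]"] stochastic_3_nonreal_eigenvalues[OF A z]
    by (simp add: algebra_simps)
  then have "complex_of_real (a + e + i) = 1 + z + cnj z \<and>
      complex_of_real (a * e + a * i + e * i - b * d - c * g - f * h) = z + cnj z + z * cnj z"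
    by (simp add: A3 cmat_def map_mat_mat3 char_poly_mat3 algebra_simps)
  then have tr: "a + e + i = 1 + 2 * Re z"
    and minors: "a * e + a * i + e * i - b * d - c * g - f * h = 2 * Re z + (Re z)\<^sup>2 + (Im z)\<^sup>2"
    by (auto simp: complex_eq_iff power2_eq_square)
  show "0 \<le> 1 + 2 * Re z"
    using tr nonneg by linarith
  have "0 \<le> b * d" "0 \<le> c * g" "0 \<le> f * h"
    using nonneg by auto
  then have "a * e + a * i + e * i \<ge> 2 * Re z + (Re z)\<^sup>2 + (Im z)\<^sup>2"
    using minors by linarith
  \<comment> \<open>\<open>(tr A)\<^sup>2\<close> is at least three times the sum of the principal minors of order two.\<close>
  moreover have "0 \<le> (a - e)\<^sup>2 + (a - i)\<^sup>2 + (e - i)\<^sup>2"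
    by simp
  moreover have "(a - e)\<^sup>2 + (a - i)\<^sup>2 + (e - i)\<^sup>2 = 2 * ((a + e + i)\<^sup>2 - 3 * (a * e + a * i + e * i))"
    by (simp add: power2_eq_square algebra_simps)
  ultimately have "3 * (Im z)\<^sup>2 \<le> (1 - Re z)\<^sup>2"
    unfolding tr by (simp add: power2_eq_square algebra_simps)
  then have "(sqrt 3 * \<bar>Im z\<bar>)\<^sup>2 \<le> (1 - Re z)\<^sup>2"
    by (simp add: power_mult_distrib)
  \<comment> \<open>Each diagonal entry is at most one, so the trace is at most three. This sign
    allows the squares to be removed.\<close>
  moreover have "0 \<le> 1 - Re z"
    using tr nonneg sums by linarith
  ultimately show "sqrt 3 * \<bar>Im z\<bar> \<le> 1 - Re z"
    by (rule power2_le_imp_le)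
qed

text \<open>The real closed form of the circulant matrix in the theorem; \<open>a\<close>,
  \<open>b\<close>, \<open>c\<close> are the entries of the inverse Fourier transform of
  \<open>(1, z, cnj z)\<close>.\<close>

definition circulant3 :: "complex \<Rightarrow> real mat" where
  "circulant3 z = (let a = (1 + 2 * Re z) / 3; b = (1 - Re z - sqrt 3 * Im z) / 3;
     c = (1 - Re z + sqrt 3 * Im z) / 3 in mat3 a c b b a c c b a)"

text \<open>The first bound makes \<open>a\<close> nonnegative, the second \<open>b\<close> and
  \<open>c\<close>; the three always add up to one.\<close>

lemma circulant3_stochastic:
  assumes "0 \<le> 1 + 2 * Re z" "sqrt 3 * \<bar>Im z\<bar> \<le> 1 - Re z"
  shows "circulant3 z \<in> stochastic_mats 3"
proof -
  have "sqrt 3 * x \<le> sqrt 3 * \<bar>Im z\<bar>" if "x \<le> \<bar>Im z\<bar>" for x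
    using that by simp
  from this[OF abs_ge_self] this[OF abs_ge_minus_self]
  have "sqrt 3 * Im z \<le> 1 - Re z" "- (sqrt 3 * Im z) \<le> 1 - Re z"
    using assms(2) by linarith+
  then show ?thesis
    using assms(1) by (auto simp: stochastic_mats_def circulant3_def Let_def all_less_3 sum_lessThan_3 field_simps)
qed

text \<open>The characteristic polynomial is computed to be
  \<open>(x - 1) * (x - z) * (x - cnj z)\<close> in expanded form, which vanishes at
  \<open>z\<close>.\<close>

lemma circulant3_eigenvalue: "eigenvalue (cmat (circulant3 z)) z"
proof -
  define a b c where "a = (1 + 2 * Re z) / 3" and "b = (1 - Re z - sqrt 3 * Im z) / 3"
    and "c = (1 - Re z + sqrt 3 * Im z) / 3"
  have B: "circulant3 z = mat3 a c b b a c c b a"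
    by (simp add: circulant3_def Let_def a_def b_def c_def)
  have sum: "a + b + c = 1"
    by (simp add: a_def b_def c_def field_simps)
  have "3 * b = 1 - Re z - sqrt 3 * Im z" "3 * c = 1 - Re z + sqrt 3 * Im z"
    by (simp_all add: b_def c_def)
  then have "(3 * b) * (3 * c) = 1 - 2 * Re z + (Re z)\<^sup>2 - 3 * (Im z)\<^sup>2"
    by (simp only:) (simp add: power2_eq_square algebra_simps)
  then have "9 * (b * c) = 1 - 2 * Re z + (Re z)\<^sup>2 - 3 * (Im z)\<^sup>2"
    by simp
  moreover have "9 * (a * a) = 1 + 4 * Re z + 4 * (Re z)\<^sup>2"
    by (simp add: a_def power2_eq_square algebra_simps)
  ultimately have minors: "3 * (a * a - b * c) = 2 * Re z + (Re z)\<^sup>2 + (Im z)\<^sup>2"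
    by (simp add: right_diff_distrib)
  have a3: "a + a + a = 1 + 2 * Re z"
    by (simp add: a_def field_simps)
  have c: "c = 1 - a - b"
    using sum by simp
  \<comment> \<open>This says that one is a root of the characteristic polynomial: the determinant
    equals the sum of the principal minors, plus one, minus the trace.\<close>
  have "a * (a * a - b * c) - c * (b * a - c * c) + b * (b * b - c * a)
      = 3 * (a * a - b * c) + 1 - 3 * a"
    unfolding c by (simp add: algebra_simps)
  then have det: "a * (a * a - b * c) - c * (b * a - c * c) + b * (b * b - c * a) = (Re z)\<^sup>2 + (Im z)\<^sup>2"
    using minors a3 by linarith
  have "char_poly (circulant3 z) = [:- ((Re z)\<^sup>2 + (Im z)\<^sup>2), 2 * Re z + (Re z)\<^sup>2 + (Im z)\<^sup>2, - (1 + 2 * Re z), 1:]"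
    unfolding B char_poly_mat3 pCons_eq_iff using minors det a3 by (simp add: algebra_simps)
  then have "char_poly (cmat (circulant3 z)) =
      map_poly of_real [:- ((Re z)\<^sup>2 + (Im z)\<^sup>2), 2 * Re z + (Re z)\<^sup>2 + (Im z)\<^sup>2, - (1 + 2 * Re z), 1:]"
    unfolding cmat_def by (subst of_real_hom.char_poly_hom[of _ 3]) (simp_all add: B)
  then have "poly (char_poly (cmat (circulant3 z))) z = 0"
    by (simp add: complex_eq_iff power2_eq_square algebra_simps)
  then show ?thesis
    by (subst eigenvalue_root_char_poly[of _ 3]) (simp_all add: B)
qed

section \<open>The circulant matrix\<close>

lemma mat3_cong:
  assumes "a = a'" "b = b'" "c = c'" "d = d'" "e = e'" "f = f'" "g = g'" "h = h'" "i = i'"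
  shows "mat3 a b c d e f g h i = mat3 a' b' c' d' e' f' g' h' i'"
  using assms by simp

lemma mat3_mult_vec:
  "mat3 a b c d e f g h i *\<^sub>v vec_of_list [x, y, z] =
    vec_of_list [a * x + b * y + c * z, d * x + e * y + f * z, g * x + h * y + i * z]"
proof (rule eq_vecI)
  fix j assume "j < dim_vec (vec_of_list [a * x + b * y + c * z, d * x + e * y + f * z, g * x + h * y + i * z])"
  then have "j < 3"
    by simp
  then show "(mat3 a b c d e f g h i *\<^sub>v vec_of_list [x, y, z]) $ j =
      vec_of_list [a * x + b * y + c * z, d * x + e * y + f * z, g * x + h * y + i * z] $ j"
    unfolding less_3_iff
    by (auto simp: scalar_prod_def numeral_2_eq_2 mat3_index[unfolded numeral_2_eq_2] add.assoc)
qed simp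

text \<open>A one-sided inverse of a square matrix is two-sided, so \<open>A\<close> is a unit and
  \<open>mat_inverse\<close> succeeds; uniqueness of inverses identifies the result.\<close>

lemma mat_inverse_eqI:
  fixes A B :: "'a :: field mat"
  assumes A: "A \<in> carrier_mat n n" and B: "B \<in> carrier_mat n n" and AB: "A * B = 1\<^sub>m n"
  shows "mat_inverse A = Some B"
proof -
  have BA: "B * A = 1\<^sub>m n"
    using mat_mult_left_right_inverse[OF A B AB] .
  have "A \<in> Units (ring_mat TYPE('a) n ())"
    using A B AB BA by (auto simp: Units_def ring_mat_def)
  then obtain C where C: "mat_inverse A = Some C"
    using mat_inverse(1)[OF A, where b = "()"] by (cases "mat_inverse A") auto
  then have CA: "C * A = 1\<^sub>m n" and C': "C \<in> carrier_mat n n"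
    using mat_inverse(2)[OF A C] by auto
  have "C = C * (A * B)"
    using C' by (simp add: AB)
  also have "\<dots> = B"
    using B by (simp add: assoc_mult_mat[OF C' A B, symmetric] CA)
  finally have "C = B" .
  with C show ?thesis
    by simp
qed

text \<open>The primitive cube root of unity \<open>cis (2 * pi / 3)\<close>, in Cartesian form so
  that identities can be checked on real and imaginary parts.\<close>

definition omega :: complex where
  "omega = Complex (- 1 / 2) (sqrt 3 / 2)"

lemma omega_simps:
  "omega * omega = cnj omega" "cnj omega * cnj omega = omega"
  "omega * cnj omega = 1" "cnj omega * omega = 1"
  "1 + omega + cnj omega = 0" "1 + cnj omega + omega = 0"
  by (simp_all add: omega_def complex_eq_iff)

lemma exp_omega: "exp (- (2 * complex_of_real pi * \<i>) / 3) = cnj omega"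
proof -
  have "exp (- (2 * complex_of_real pi * \<i>) / 3) = cis (- (2 * pi / 3))"
    by (simp add: cis_conv_exp algebra_simps)
  also have "\<dots> = cnj omega"
    by (simp add: complex_eq_iff omega_def cos_120 sin_120)
  finally show ?thesis .
qed

text \<open>The entries are powers of \<open>cnj omega\<close> with exponents 0, 1, 2 and 4, reduced
  modulo three.\<close>

lemma fourier_mat_3:
  "fourier_mat 3 = mat3 1 1 1 1 (cnj omega) omega 1 omega (cnj omega)"
proof -
  have F: "exp (- 2 * complex_of_real pi * \<i> * of_nat j * of_nat k / of_nat 3) = cnj omega ^ (j * k)" for j k
    unfolding exp_omega[symmetric] exp_of_nat_mult[symmetric] by (simp add: field_simps)
  have p: "cnj omega ^ 2 = omega" "cnj omega ^ 4 = cnj omega"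
    by (simp_all add: omega_simps eval_nat_numeral)
  show ?thesis
    unfolding fourier_mat_def F by (rule eq_mat_3I) (simp_all add: p)
qed

text \<open>The inverse is a third of the entrywise conjugate; the off-diagonal products vanish
  because the cube roots of unity add up to zero.\<close>

lemma mat_inverse_fourier_mat_3:
  "mat_inverse (fourier_mat 3) =
    Some ((1 / 3) \<cdot>\<^sub>m mat3 1 1 1 1 omega (cnj omega) 1 (cnj omega) omega)"
proof (rule mat_inverse_eqI[of _ 3])
  have "fourier_mat 3 * mat3 1 1 1 1 omega (cnj omega) 1 (cnj omega) omega = mat3 3 0 0 0 3 0 0 0 3"
    unfolding fourier_mat_3 mat3_mult by (rule mat3_cong) (simp_all add: omega_simps)
  moreover have "fourier_mat 3 * ((1 / 3) \<cdot>\<^sub>m mat3 1 1 1 1 omega (cnj omega) 1 (cnj omega) omega) =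
      (1 / 3) \<cdot>\<^sub>m (fourier_mat 3 * mat3 1 1 1 1 omega (cnj omega) 1 (cnj omega) omega)"
    by (rule mult_smult_distrib[of _ 3 3 _ 3]) (simp_all add: fourier_mat_3)
  ultimately show "fourier_mat 3 * ((1 / 3) \<cdot>\<^sub>m mat3 1 1 1 1 omega (cnj omega) 1 (cnj omega) omega) = 1\<^sub>m 3"
    by (simp add: mat3_smult mat3_one)
qed (simp_all add: fourier_mat_3)

text \<open>The powers 0, 1, 2 of the shift have disjoint supports covering all nine positions, so
  each entry is a single coefficient.\<close>

lemma circ_3: "circ (vec_of_list [a, b, c]) = mat3 a c b b a c c b a"
proof -
  have P: "(cyclic_shift 3 :: 'a mat) = mat3 0 0 1 1 0 0 0 1 0"
    unfolding cyclic_shift_def by (rule eq_mat_3I) simp_all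
  have P2: "(cyclic_shift 3 :: 'a mat) ^\<^sub>m 2 = mat3 0 1 0 0 0 1 1 0 0"
    using P by (simp add: numeral_2_eq_2 mat3_mult mat3_one)
  have P0: "(cyclic_shift 3 :: 'a mat) ^\<^sub>m 0 = mat3 1 0 0 0 1 0 0 0 1"
    and P1: "(cyclic_shift 3 :: 'a mat) ^\<^sub>m 1 = mat3 0 0 1 1 0 0 0 1 0"
    by (simp_all add: P mat3_one mat3_mult)
  have dim: "dim_vec (vec_of_list [a, b, c]) = 3"
    and idx: "vec_of_list [a, b, c] $ 0 = a" "vec_of_list [a, b, c] $ 1 = b" "vec_of_list [a, b, c] $ 2 = c"
    by (simp_all add: numeral_2_eq_2)
  show ?thesis
    unfolding circ_def Let_def dim sum_lessThan_3 P0 P1 P2 idx by (rule eq_mat_3I) simp_all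
qed

text \<open>The inverse transform is real because \<open>(1, z, cnj z)\<close> is conjugate
  symmetric: \<open>omega * z + cnj omega * cnj z\<close> is twice the real part of
  \<open>omega * z\<close>.\<close>

lemma cmat_circulant3:
  "cmat (circulant3 z) = circ (the (mat_inverse (fourier_mat 3)) *\<^sub>v vec_of_list [1, z, cnj z])"
proof -
  have "the (mat_inverse (fourier_mat 3)) *\<^sub>v vec_of_list [1, z, cnj z] =
      vec_of_list [(1 + z + cnj z) / 3, (1 + omega * z + cnj omega * cnj z) / 3,
        (1 + cnj omega * z + omega * cnj z) / 3]"
    by (simp only: mat_inverse_fourier_mat_3 option.sel mat3_smult mat3_mult_vec) (simp add: add_divide_distrib)
  moreover have "1 + z + cnj z = of_real (1 + 2 * Re z)"
    "1 + omega * z + cnj omega * cnj z = of_real (1 - Re z - sqrt 3 * Im z)"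
    "1 + cnj omega * z + omega * cnj z = of_real (1 - Re z + sqrt 3 * Im z)"
    by (simp_all add: complex_eq_iff omega_def)
  ultimately show ?thesis
    by (simp only: circ_3) (simp add: circulant3_def Let_def cmat_def map_mat_mat3)
qed

text \<open>The sign \<open>s\<close> of the third column exchanges the blocks of \<open>z\<close> and \<open>cnj z\<close>, which handles both
  orders of the conjugate pair in an eigenvalue vector.\<close>
definition schur_basis :: "real \<Rightarrow> real \<Rightarrow> real \<Rightarrow> real mat" where
  "schur_basis s p q = (1 / sqrt 3) \<cdot>\<^sub>m
    mat3 1 (sqrt 3 * p) (s * (- p - 2 * q)) 1 (sqrt 3 * q) (s * (2 * p + q)) 1 (sqrt 3 * (- p - q)) (s * (q - p))"

text \<open>The condition on \<open>p\<close> and \<open>q\<close> says that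
  \<open>(p, q, - p - q)\<close>, which is orthogonal to the all-ones vector, has norm one. Up to
  the sign \<open>s\<close>, the third column is the cross product of the first two. Both claims are
  checked entry by entry.\<close>

lemma schur_basis_decomposition:
  assumes pq: "p\<^sup>2 + q\<^sup>2 + p * q = 1 / 2" and s: "s * s = 1"
  shows "schur_basis s p q \<in> orthogonal_group 3"
    "circulant3 z = schur_basis s p q * mat3 1 0 0 0 (Re z) (s * Im z) 0 (- s * Im z) (Re z) *
      transpose_mat (schur_basis s p q)"
proof -
  define k where "k = 1 / sqrt 3"
  have k: "3 * (k * k) = 1" "k * sqrt 3 = 1" and r: "sqrt 3 = 3 * k"
    by (simp_all add: k_def field_simps)
  have Q: "schur_basis s p q = mat3 k p (k * (s * (- p - 2 * q))) k q (k * (s * (2 * p + q))) k (- p - q) (k * (s * (q - p)))"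
    by (simp add: schur_basis_def k_def mat3_smult)
  have kk: "k * k = 1 / 3" "k * (k * x) = x / 3" for x
    using k(1) by (simp_all add: field_simps)
  have ss: "s * (s * x) = x" for x
    using s by (simp flip: mult.assoc)
  \<comment> \<open>Read as rewrite rules, these equations eliminate \<open>q * q\<close>; the
    second form catches it inside a longer right-nested product.\<close>
  have "q * q = 1 / 2 - p * p - p * q"
    using pq by (simp add: power2_eq_square)
  moreover from this have "q * (q * x) = x / 2 - p * (p * x) - p * (q * x)" for x
    by (simp add: left_diff_distrib flip: mult.assoc)
  ultimately have reduce: "q * q = 1 / 2 - p * p - p * q"
      "q * (q * x) = x / 2 - p * (p * x) - p * (q * x)" for x
    by auto
  have "schur_basis s p q * transpose_mat (schur_basis s p q) = 1\<^sub>m 3"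
    unfolding Q mat3_transpose mat3_mult mat3_one
    by (rule mat3_cong) (simp_all add: algebra_simps kk s ss reduce)
  then show "schur_basis s p q \<in> orthogonal_group 3"
    using mat_mult_left_right_inverse[of "schur_basis s p q" 3 "transpose_mat (schur_basis s p q)"]
    by (auto simp: orthogonal_group_def inverts_mat_def Q mat3_transpose)
  show "circulant3 z = schur_basis s p q * mat3 1 0 0 0 (Re z) (s * Im z) 0 (- s * Im z) (Re z) *
      transpose_mat (schur_basis s p q)"
    unfolding Q mat3_transpose mat3_mult circulant3_def Let_def r
    by (rule mat3_cong) (simp_all add: algebra_simps kk s ss reduce, simp_all add: field_simps)
qed

section \<open>Eigenvalue vectors with a conjugate pair\<close>

lemma num_real_real_pair:
  assumes "z \<notin> \<real>"
  shows "num_real (vec_of_list [1, z, cnj z]) = 1"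
  using assms by (auto simp: num_real_eq_size Reals_cnj_iff)

lemma block_D_real_pair:
  assumes "z \<notin> \<real>"
  shows "block_D (vec_of_list [1, z, cnj z]) = mat3 1 0 0 0 (Re z) (Im z) 0 (- Im z) (Re z)"
proof -
  have "num_pairs (vec_of_list [1, z, cnj z]) = 1"
    using num_real_real_pair[OF assms] by (simp add: num_pairs_def)
  then have "block_D (vec_of_list [1, z, cnj z]) = diag_block_mat [mat 1 1 (\<lambda>_. 1), conj_block z]"
    using num_real_real_pair[OF assms] by (simp add: block_D_def)
  also have "\<dots> = mat3 1 0 0 0 (Re z) (Im z) 0 (- Im z) (Re z)"
  proof (rule eq_matI)
    have dims: "dim_row (conj_block z) = 2" "dim_col (conj_block z) = 2"
      by (simp_all add: conj_block_def mat_of_rows_list_def)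
    fix i j :: nat assume "i < dim_row (mat3 1 0 0 0 (Re z) (Im z) 0 (- Im z) (Re z))"
      "j < dim_col (mat3 1 0 0 0 (Re z) (Im z) 0 (- Im z) (Re z))"
    then have "i = 0 \<or> i = 1 \<or> i = 2" "j = 0 \<or> j = 1 \<or> j = 2"
      by auto
    then show "diag_block_mat [mat 1 1 (\<lambda>_. 1), conj_block z] $$ (i, j) =
        mat3 1 0 0 0 (Re z) (Im z) 0 (- Im z) (Re z) $$ (i, j)"
      by (auto simp: dims) (auto simp: conj_block_def mat_of_rows_list_def)
  qed (simp_all add: conj_block_def mat_of_rows_list_def)
  finally show ?thesis .
qed

text \<open>The only real eigenvalue has to come first, so the order of the conjugate pair is the
  only freedom.\<close>

lemma eigenvalue_vector_real_pair:
  assumes ev: "eigenvalues A = {#1, z, cnj z#}" and z: "z \<notin> \<real>"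
  shows "eigenvalue_vector A \<Lambda> \<longleftrightarrow>
    \<Lambda> = vec_of_list [1, z, cnj z] \<or> \<Lambda> = vec_of_list [1, cnj z, z]"
proof
  have z': "cnj z \<notin> \<real>"
    using z by simp
  \<comment> \<open>Stated for a general \<open>w\<close>, so that \<open>z\<close> and
    \<open>cnj z\<close> cover both orders.\<close>
  have *: "eigenvalue_vector A (vec_of_list [1, w, cnj w])"
    if w: "w \<notin> \<real>" and m: "{#1, w, cnj w#} = {#1, z, cnj z#}" for w
  proof -
    define L where "L = vec_of_list [1, w, cnj w]"
    have L: "L $ 0 = 1" "L $ 1 = w" "L $ 2 = cnj w" "dim_vec L = 3" "list_of_vec L = [1, w, cnj w]"
      by (simp_all add: L_def numeral_2_eq_2 list_vec)
    have nr: "num_real L = 1"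
      using num_real_real_pair[OF w] by (simp only: L_def)
    then have np: "num_pairs L = 1"
      by (simp add: num_pairs_def L)
    have "L $ i \<notin> \<real>" if "1 \<le> i \<and> i < 3" for i
    proof -
      have "i = 1 \<or> i = 2"
        using that by auto
      then show ?thesis
        using w L by auto
    qed
    then have "conjugate_ordered L"
      using L by (simp add: conjugate_ordered_def nr np numeral_2_eq_2)
    then have "eigenvalue_vector A L"
      using m by (simp add: eigenvalue_vector_def ev L)
    then show ?thesis
      by (simp only: L_def)
  qed
  assume "\<Lambda> = vec_of_list [1, z, cnj z] \<or> \<Lambda> = vec_of_list [1, cnj z, z]"
  then show "eigenvalue_vector A \<Lambda>"
    using *[OF z] *[of "cnj z"] z' by (auto simp: add_mset_commute)
next
  assume "eigenvalue_vector A \<Lambda>"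
  then have co: "conjugate_ordered \<Lambda>" and m: "mset (list_of_vec \<Lambda>) = {#1, z, cnj z#}"
    by (auto simp: eigenvalue_vector_def ev)
  have "length (list_of_vec \<Lambda>) = 3"
    using arg_cong[OF m, of size] by simp
  moreover have "\<exists>a b c. xs = [a, b, c]" if "length xs = 3" for xs :: "complex list"
    using that by (auto simp: numeral_3_eq_3 length_Suc_conv)
  ultimately obtain a b c where "list_of_vec \<Lambda> = [a, b, c]"
    by blast
  then have L: "\<Lambda> = vec_of_list [a, b, c]"
    by (metis vec_list)
  have nr: "num_real \<Lambda> = 1"
    using z by (auto simp: num_real_eq_size m Reals_cnj_iff)
  then have "num_pairs \<Lambda> = 1"
    by (simp add: num_pairs_def L)
  with co nr have "\<Lambda> $ 0 \<in> \<real>" "\<Lambda> $ 2 = cnj (\<Lambda> $ 1)"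
    by (auto simp: conjugate_ordered_def Let_def numeral_2_eq_2)
  then have "a \<in> \<real>" "c = cnj b"
    by (simp_all add: L numeral_2_eq_2)
  moreover have abc: "{#a, b, c#} = {#1, z, cnj z#}"
    using m L by (simp add: list_vec)
  then have "a \<in># {#1, z, cnj z#}"
    by (metis union_single_eq_member)
  then have "a = 1 \<or> a = z \<or> a = cnj z"
    by simp
  moreover have "cnj z \<notin> \<real>"
    using z by simp
  ultimately have "a = 1"
    using z by blast
  then have "{#b, c#} = {#z, cnj z#}"
    using abc by simp
  then have "b \<in># {#z, cnj z#}"
    by (metis union_single_eq_member)
  then have "b = z \<or> b = cnj z"
    by simp
  then show "\<Lambda> = vec_of_list [1, z, cnj z] \<or> \<Lambda> = vec_of_list [1, cnj z, z]"
    using L \<open>a = 1\<close> \<open>c = cnj b\<close> by auto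
qed

text \<open>The block diagonal form is reached exactly, so \<open>V\<close> is the zero
  matrix.\<close>

lemma circulant3_mem_Iso:
  assumes z: "z \<notin> \<real>" and w: "w = z \<or> w = cnj z"
  shows "circulant3 z \<in> Iso (vec_of_list [1, w, cnj w])"
proof -
  \<comment> \<open>The sign is 1 for \<open>w = z\<close> and -1 for
    \<open>w = cnj z\<close>.\<close>
  obtain s :: real where s: "s * s = 1" "Re w = Re z" "Im w = s * Im z"
    using w that[of 1] that[of "- 1"] by auto
  have wr: "w \<notin> \<real>"
    using z w by (auto simp: Reals_cnj_iff)
  define L where "L = vec_of_list [1, w, cnj w]"
  have dim: "dim_vec L = 3"
    by (simp add: L_def)
  have nr: "num_real L = 1"
    using num_real_real_pair[OF wr] by (simp only: L_def)
  have D: "block_D L = mat3 1 0 0 0 (Re w) (Im w) 0 (- Im w) (Re w)"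
    using block_D_real_pair[OF wr] by (simp only: L_def)
  \<comment> \<open>One convenient solution of the normalisation condition; any other would
    serve.\<close>
  define Q where "Q = schur_basis s (1 / sqrt 2) 0"
  have "(1 / sqrt 2)\<^sup>2 + 0\<^sup>2 + (1 / sqrt 2) * 0 = (1 / 2 :: real)"
    by (simp add: power_divide)
  note dec = schur_basis_decomposition[OF this s(1), folded Q_def]
  have "block_D L + 0\<^sub>m 3 3 = block_D L"
    unfolding D by simp
  then have "circulant3 z = Q * (block_D L + 0\<^sub>m 3 3) * transpose_mat Q"
    using dec(2)[of z] s by (simp add: D)
  moreover have "0\<^sub>m 3 3 \<in> V_set 3 (num_real L) (num_pairs L)"
    unfolding V_set_def num_pairs_def nr dim by auto
  ultimately have "circulant3 z \<in> Iso L"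
    unfolding Iso_def dim mem_Collect_eq using dec(1) by blast
  then show ?thesis
    by (simp only: L_def)
qed

text \<open>Both matrices are stochastic with the nonreal eigenvalue \<open>z\<close>, which
  determines the whole spectrum.\<close>

lemma stochastic_3_circulant3:
  assumes A: "A \<in> stochastic_mats 3" and z: "z \<in># eigenvalues A" "z \<notin> \<real>"
  shows "circulant3 z \<in> stochastic_mats 3" "eigenvalues (circulant3 z) = eigenvalues A"
proof -
  show B: "circulant3 z \<in> stochastic_mats 3"
    using stochastic_3_nonreal_eigenvalue_bounds[OF A z] by (rule circulant3_stochastic)
  then have "z \<in># eigenvalues (circulant3 z)"
    using circulant3_eigenvalue mem_eigenvalues_iff[of "circulant3 z" 3] by (simp add: stochastic_mats_def)
  then show "eigenvalues (circulant3 z) = eigenvalues A"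
    using stochastic_3_nonreal_eigenvalues[OF B] stochastic_3_nonreal_eigenvalues[OF A z] z(2) by simp
qed

text \<open>The first claim keeps the second from being vacuous. In the second, \<open>B\<close> is
  chosen before \<open>\<Lambda>\<close>, so one matrix serves every admissible order of the
  eigenvalues.\<close>

lemma stochastic_3_Iso:
  assumes A: "A \<in> stochastic_mats 3"
  shows "\<exists>\<Lambda>. eigenvalue_vector A \<Lambda>"
    "\<exists>B \<in> stochastic_mats 3. eigenvalues B = eigenvalues A \<and> (\<forall>\<Lambda>. eigenvalue_vector A \<Lambda> \<longrightarrow> B \<in> Iso \<Lambda>)"
proof -
  have C: "A \<in> carrier_mat 3 3"
    using A by (simp add: stochastic_mats_def)
  have "(\<exists>\<Lambda>. eigenvalue_vector A \<Lambda>) \<and>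
    (\<exists>B \<in> stochastic_mats 3. eigenvalues B = eigenvalues A \<and> (\<forall>\<Lambda>. eigenvalue_vector A \<Lambda> \<longrightarrow> B \<in> Iso \<Lambda>))"
  proof (cases "\<forall>z \<in># eigenvalues A. z \<in> \<real>")
    case True
    then show ?thesis
      using real_eigenvalues_mem_Iso[OF C] real_eigenvalues_ex_eigenvalue_vector[of A] A by blast
  next
    case False
    then obtain z where z: "z \<in># eigenvalues A" "z \<notin> \<real>"
      by blast
    note ev = eigenvalue_vector_real_pair[OF stochastic_3_nonreal_eigenvalues[OF A z] z(2)]
    show ?thesis
      using stochastic_3_circulant3[OF A z] circulant3_mem_Iso[OF z(2), of z]
        circulant3_mem_Iso[OF z(2), of "cnj z"] by (auto simp only: ev complex_cnj_cnj)
  qed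
  then show "\<exists>\<Lambda>. eigenvalue_vector A \<Lambda>"
    "\<exists>B \<in> stochastic_mats 3. eigenvalues B = eigenvalues A \<and> (\<forall>\<Lambda>. eigenvalue_vector A \<Lambda> \<longrightarrow> B \<in> Iso \<Lambda>)"
    by blast+
qed

text \<open>The circulant is formed over the complex numbers, so the real matrix it represents is
  given as a \<open>B\<close> whose complexification \<open>cmat B\<close> equals it.\<close>

theorem proposition3p6:
  fixes A :: "real mat"
  assumes "A \<in> stochastic_mats 3"
  shows "(\<exists>\<Lambda>. eigenvalue_vector A \<Lambda>) \<and>
    (\<exists>B \<in> stochastic_mats 3. eigenvalues B = eigenvalues A \<and>
      (\<forall>\<Lambda>. eigenvalue_vector A \<Lambda> \<longrightarrow> B \<in> Iso \<Lambda>)) \<and>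
    (\<forall>(\<mu>\<^sub>R :: real) (\<mu>\<^sub>I :: real) (\<mu> :: complex).
      \<mu> = complex_of_real \<mu>\<^sub>R + \<i> * complex_of_real \<mu>\<^sub>I \<and> \<mu>\<^sub>I \<noteq> 0 \<and> eigenvalue (cmat A) \<mu> \<longrightarrow>
      (\<exists>B \<in> stochastic_mats 3.
        cmat B = circ (the (mat_inverse (fourier_mat 3)) *\<^sub>v vec_of_list [1, \<mu>, cnj \<mu>]) \<and>
        eigenvalues B = eigenvalues A \<and>
        (\<forall>(q\<^sub>1 :: real) (q\<^sub>2 :: real) (q\<^sub>3 :: real) (Q :: real mat).
          q\<^sub>3 = - (q\<^sub>1 + q\<^sub>2) \<and> q\<^sub>1\<^sup>2 + q\<^sub>2\<^sup>2 + q\<^sub>1 * q\<^sub>2 = 1 / 2 \<and>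
          Q = (1 / sqrt 3) \<cdot>\<^sub>m mat_of_rows_list 3
                [[1, sqrt 3 * q\<^sub>1, q\<^sub>3 - q\<^sub>2],
                 [1, sqrt 3 * q\<^sub>2, q\<^sub>1 - q\<^sub>3],
                 [1, sqrt 3 * q\<^sub>3, q\<^sub>2 - q\<^sub>1]] \<longrightarrow>
          B = Q * mat_of_rows_list 3
                    [[1, 0, 0],
                     [0, \<mu>\<^sub>R, \<mu>\<^sub>I],
                     [0, - \<mu>\<^sub>I, \<mu>\<^sub>R]] * transpose_mat Q)))"
proof (intro conjI allI impI stochastic_3_Iso[OF assms]; (elim conjE)?)
  fix \<mu>\<^sub>R \<mu>\<^sub>I :: real and \<mu> :: complex
  assume \<mu>: "\<mu> = complex_of_real \<mu>\<^sub>R + \<i> * complex_of_real \<mu>\<^sub>I" "\<mu>\<^sub>I \<noteq> 0" and "eigenvalue (cmat A) \<mu>"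
  then have ev: "\<mu> \<in># eigenvalues A"
    using assms mem_eigenvalues_iff[of A 3 \<mu>] by (simp add: stochastic_mats_def)
  have re: "Re \<mu> = \<mu>\<^sub>R" "Im \<mu> = \<mu>\<^sub>I"
    by (simp_all add: \<mu>(1))
  then have nonreal: "\<mu> \<notin> \<real>"
    using \<mu>(2) by (auto simp: complex_is_Real_iff)
  show "\<exists>B \<in> stochastic_mats 3.
        cmat B = circ (the (mat_inverse (fourier_mat 3)) *\<^sub>v vec_of_list [1, \<mu>, cnj \<mu>]) \<and>
        eigenvalues B = eigenvalues A \<and>
        (\<forall>(q\<^sub>1 :: real) (q\<^sub>2 :: real) (q\<^sub>3 :: real) (Q :: real mat).
          q\<^sub>3 = - (q\<^sub>1 + q\<^sub>2) \<and> q\<^sub>1\<^sup>2 + q\<^sub>2\<^sup>2 + q\<^sub>1 * q\<^sub>2 = 1 / 2 \<and>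
          Q = (1 / sqrt 3) \<cdot>\<^sub>m mat_of_rows_list 3
                [[1, sqrt 3 * q\<^sub>1, q\<^sub>3 - q\<^sub>2],
                 [1, sqrt 3 * q\<^sub>2, q\<^sub>1 - q\<^sub>3],
                 [1, sqrt 3 * q\<^sub>3, q\<^sub>2 - q\<^sub>1]] \<longrightarrow>
          B = Q * mat_of_rows_list 3
                    [[1, 0, 0],
                     [0, \<mu>\<^sub>R, \<mu>\<^sub>I],
                     [0, - \<mu>\<^sub>I, \<mu>\<^sub>R]] * transpose_mat Q)"
  proof (intro bexI[of _ "circulant3 \<mu>"] conjI allI impI; (elim conjE)?)
    fix q\<^sub>1 q\<^sub>2 q\<^sub>3 :: real and Q :: "real mat"
    assume q: "q\<^sub>3 = - (q\<^sub>1 + q\<^sub>2)" "q\<^sub>1\<^sup>2 + q\<^sub>2\<^sup>2 + q\<^sub>1 * q\<^sub>2 = 1 / 2"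
      and Q: "Q = (1 / sqrt 3) \<cdot>\<^sub>m mat_of_rows_list 3
                [[1, sqrt 3 * q\<^sub>1, q\<^sub>3 - q\<^sub>2],
                 [1, sqrt 3 * q\<^sub>2, q\<^sub>1 - q\<^sub>3],
                 [1, sqrt 3 * q\<^sub>3, q\<^sub>2 - q\<^sub>1]]"
    \<comment> \<open>Substituting for the third parameter turns the prescribed matrix into the
      basis with sign 1, which belongs to the block of \<open>\<mu>\<close> itself.\<close>
    have "Q = schur_basis 1 q\<^sub>1 q\<^sub>2"
      unfolding Q schur_basis_def mat3_def by (simp add: q(1) algebra_simps)
    then show "circulant3 \<mu> = Q * mat_of_rows_list 3
                    [[1, 0, 0],
                     [0, \<mu>\<^sub>R, \<mu>\<^sub>I],
                     [0, - \<mu>\<^sub>I, \<mu>\<^sub>R]] * transpose_mat Q"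
      using schur_basis_decomposition(2)[OF q(2), of 1 \<mu>] by (simp add: re mat3_def)
  qed (use cmat_circulant3 stochastic_3_circulant3[OF assms ev nonreal] in auto)
qed

end
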